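(* Let $K\in\{\mathbb{R},\mathbb{C}\}$, let $A$ be a unitary algebra over $K$ with basis $\{e_0=1,e_1,\dots,e_n\}$, and for $m\in\mathbb{N}$ let $F_m=\sum_{k=0}^{n} f_{m+k}e_k\in A$, where $(f_j)$ is the Fibonacci sequence. Then: 1) $F_{m+2}=F_{m+1}+F_m$ for all $m\in\mathbb{N}$; 2) $\sum_{i=0}^{p}F_i=F_{p+2}-F_1$ for all $p\in\mathbb{N}$.
   Context: The Fibonacci sequence is $f_0=0$, $f_1=1$, $f_j=f_{j-1}+f_{j-2}$ for $j\ge 2$. Here $\mathbb{N}=\{0,1,2,\dots\}$. The algebra $A$ is arbitrary with unit $e_0=1$: its multiplication is $K$-bilinear and is not assumed to be commutative or associative. The elements $F_m$ are called Fibonacci elements of $A$. *)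

theory Defs
  imports Complex_Main "HOL-Number_Theory.Fib"
begin

text \<open>The algebra is the whole type \<open>'a\<close>. The multiplication is a locale parameter rather than
  the operation of a ring class because it need not be associative or commutative.\<close>

locale unital_algebra = vector_space scale
  for scale :: "'k::field \<Rightarrow> 'a::ab_group_add \<Rightarrow> 'a" +
  fixes mult :: "'a \<Rightarrow> 'a \<Rightarrow> 'a"
    and unit :: 'a
  assumes mult_add_left: "mult (x + y) z = mult x z + mult y z"
    and mult_add_right: "mult x (y + z) = mult x y + mult x z"
    and mult_scale_left: "mult (scale c x) y = scale c (mult x y)"
    and mult_scale_right: "mult x (scale c y) = scale c (mult x y)"
    and mult_unit_left: "mult unit x = x"
    and mult_unit_right: "mult x unit = x"

locale unital_algebra_with_basis = unital_algebra scale mult unit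
  for scale :: "'k::field \<Rightarrow> 'a::ab_group_add \<Rightarrow> 'a"
    and mult :: "'a \<Rightarrow> 'a \<Rightarrow> 'a"
    and unit :: 'a +
  fixes n :: nat
    and e :: "nat \<Rightarrow> 'a"  \<comment> \<open>only the values at \<open>0, \<dots>, n\<close> matter\<close>
  assumes e_0: "e 0 = unit"
    and e_inj: "inj_on e {0..n}"
    and e_independent: "independent (e ` {0..n})"
    and e_span: "span (e ` {0..n}) = UNIV"

definition fibonacci_element ::
  "('k::field \<Rightarrow> 'a::ab_group_add \<Rightarrow> 'a) \<Rightarrow> nat \<Rightarrow> (nat \<Rightarrow> 'a) \<Rightarrow> nat \<Rightarrow> 'a" where
  "fibonacci_element scale n e m = (\<Sum>k=0..n. scale (of_nat (fib (m + k))) (e k))"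

end

theory Submission
  imports Defs
begin

text \<open>A Fibonacci element is a linear combination of fixed vectors whose coefficients are shifted
  Fibonacci numbers. The Fibonacci recurrence holds in each coefficient, and scalar multiplication
  is additive in the scalar, so the elements satisfy the same recurrence
  (\<open>fibonacci_element_recurrence\<close>). The sum formula is then the telescoping of
  \<open>F i = F (i + 2) - F (i + 1)\<close>; this takes place in the
  abelian group of vectors and is stated for sequences there (\<open>sum_of_fibonacci_recurrence\<close>).
  Both identities are proved for vector spaces over a field, and the real and the complex case are
  instances.\<close>

lemma (in vector_space) fibonacci_element_recurrence:
  "fibonacci_element scale n e (m + 2) =
    fibonacci_element scale n e (m + 1) + fibonacci_element scale n e m"
  by (simp add: fibonacci_element_def scale_left_distrib sum.distrib)

lemma sum_of_fibonacci_recurrence: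
  fixes F :: "nat \<Rightarrow> 'a::ab_group_add"
  assumes "\<And>m. F (m + 2) = F (m + 1) + F m"
  shows "(\<Sum>i=0..p. F i) = F (p + 2) - F 1"
proof -
  have "(\<Sum>i=0..p. F i) = (\<Sum>i=0..p. F (Suc (Suc i)) - F (Suc i))"
    using assms by simp
  also have "\<dots> = F (p + 2) - F 1"
    using sum_Suc_diff[of 0 p "\<lambda>i. F (Suc i)"] by simp
  finally show ?thesis .
qed

lemma (in vector_space) sum_fibonacci_elements:
  "(\<Sum>i=0..p. fibonacci_element scale n e i) =
    fibonacci_element scale n e (p + 2) - fibonacci_element scale n e 1"
  by (rule sum_of_fibonacci_recurrence) (rule fibonacci_element_recurrence)

theorem proposition2p1:
  fixes scaleR :: "real \<Rightarrow> 'a::ab_group_add \<Rightarrow> 'a"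
    and multR :: "'a \<Rightarrow> 'a \<Rightarrow> 'a" and unitR :: 'a
    and nR :: nat and eR :: "nat \<Rightarrow> 'a"
    and scaleC :: "complex \<Rightarrow> 'b::ab_group_add \<Rightarrow> 'b"
    and multC :: "'b \<Rightarrow> 'b \<Rightarrow> 'b" and unitC :: 'b
    and nC :: nat and eC :: "nat \<Rightarrow> 'b"
  shows "(unital_algebra_with_basis scaleR multR unitR nR eR \<longrightarrow>
      (let F = fibonacci_element scaleR nR eR in
        (\<forall>m. F (m + 2) = F (m + 1) + F m) \<and>
        (\<forall>p. (\<Sum>i=0..p. F i) = F (p + 2) - F 1))) \<and>
    (unital_algebra_with_basis scaleC multC unitC nC eC \<longrightarrow>
      (let F = fibonacci_element scaleC nC eC in
        (\<forall>m. F (m + 2) = F (m + 1) + F m) \<and>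
        (\<forall>p. (\<Sum>i=0..p. F i) = F (p + 2) - F 1)))"
  unfolding Let_def unital_algebra_with_basis_def unital_algebra_def
  by (blast intro: vector_space.fibonacci_element_recurrence vector_space.sum_fibonacci_elements)

end
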